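(* The submanifold \[ \mathcal{L}_2 := \left\{ \left[ \bar{\alpha}^2 + \bar{\beta}^2 : \sqrt{2}(\bar{\alpha} \beta - \alpha \bar{\beta}) : \alpha^2 + \beta^2 \right] \;\middle|\; \alpha, \beta \in \mathbb{C},\ |\alpha|^2+|\beta|^2=1 \right\} \] of $\mathbb{CP}^2$ is lagrangian with respect to the Fubini-Study symplectic form $\omega$.
   Context: $\mathbb{CP}^2$ has homogeneous coordinates $[z_0:z_1:z_2]$ and is equipped with the Fubini-Study symplectic form $\omega$, scaled so that the total volume is $\frac{\pi^2}{2}$; equivalently, $\omega$ is obtained from the standard form $\frac{i}{2}\sum_{j=0}^2 du_j\wedge d\bar u_j$ on $\mathbb{C}^3$ by symplectic reduction at the unit sphere: $\mathbb{CP}^2 = S^5/S^1$, where $S^1$ acts by scalar multiplication. The set $\mathcal{L}_2$ is a smooth embedded real 2-dimensional submanifold of $\mathbb{CP}^2$, diffeomorphic to $\mathbb{RP}^2$. A submanifold is lagrangian if it has half the real dimension of the ambient manifold (here, dimension 2) and $\omega$ pulls back to zero on it. *)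

theory Defs
  imports "HOL-Analysis.Analysis"
begin

section \<open>Smooth maps on open subsets of Euclidean space\<close>

text \<open>\<open>Ck_on n S f\<close> is meant for open \<open>S\<close> and finite-dimensional domains: all iterated directional
  derivatives of \<open>f\<close> up to order \<open>n\<close> exist and are continuous on \<open>S\<close>.\<close>

primrec Ck_on ::
  "nat \<Rightarrow> 'a::euclidean_space set \<Rightarrow> ('a \<Rightarrow> 'b::euclidean_space) \<Rightarrow> bool" where
  "Ck_on 0 S f \<longleftrightarrow> continuous_on S f"
| "Ck_on (Suc n) S f \<longleftrightarrow>
     (\<forall>x\<in>S. f differentiable (at x)) \<and> (\<forall>v. Ck_on n S (\<lambda>x. frechet_derivative f (at x) v))"

definition smooth_on :: "'a::euclidean_space set \<Rightarrow> ('a \<Rightarrow> 'b::euclidean_space) \<Rightarrow> bool" where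
  "smooth_on S f \<longleftrightarrow> (\<forall>n. Ck_on n S f)"


section \<open>The complex projective plane\<close>

text \<open>The homogeneous coordinates \<open>z\<^sub>0, z\<^sub>1, z\<^sub>2\<close> of the text are the components \<open>z $ 1, z $ 2, z $ 3\<close>
  of \<open>z :: complex ^ 3\<close>.\<close>

definition proj_rel :: "complex ^ 3 \<Rightarrow> complex ^ 3 \<Rightarrow> bool" where
  "proj_rel z w \<longleftrightarrow> z \<noteq> 0 \<and> w \<noteq> 0 \<and> (\<exists>c. w = c *s z)"

lemma part_equivp_proj_rel: "part_equivp proj_rel"
proof (rule part_equivpI)
  show "\<exists>z. proj_rel z z"
    by (rule exI[of _ "axis 1 1"]) (auto simp: proj_rel_def axis_eq_0_iff intro!: exI[of _ 1])
  show "symp proj_rel"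
  proof (rule sympI)
    fix z w assume "proj_rel z w"
    then obtain c where c: "z \<noteq> 0" "w \<noteq> 0" "w = c *s z" by (auto simp: proj_rel_def)
    then have "c \<noteq> 0" by auto
    then have "z = inverse c *s w" using c by (simp add: vec_eq_iff)
    then show "proj_rel w z" using c(1,2) unfolding proj_rel_def by blast
  qed
  show "transp proj_rel"
    by (rule transpI) (auto simp: proj_rel_def)
qed

quotient_type cp2 = "complex ^ 3" / partial: proj_rel
  by (rule part_equivp_proj_rel)

text \<open>\<open>proj z\<close> is the point \<open>[z]\<close>; it is meaningful only for \<open>z \<noteq> 0\<close>.\<close>

definition proj :: "complex ^ 3 \<Rightarrow> cp2" where
  "proj = abs_cp2"

definition hpoint :: "complex \<Rightarrow> complex \<Rightarrow> complex \<Rightarrow> cp2" where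
  "hpoint z0 z1 z2 = proj (vector [z0, z1, z2])"

lemma proj_eq_iff:
  assumes "z \<noteq> 0" "w \<noteq> 0"
  shows "proj z = proj w \<longleftrightarrow> (\<exists>c. w = c *s z)"
proof -
  have refl: "proj_rel x x" if "x \<noteq> 0" for x
    using that by (auto simp: proj_rel_def intro!: exI[of _ 1])
  have "proj_rel z w \<longleftrightarrow> proj z = proj w"
    using Quotient3_rel[OF Quotient3_cp2, of z w] refl assms unfolding proj_def by blast
  then show ?thesis using assms by (simp add: proj_rel_def)
qed

lemma proj_surj: "\<exists>z. z \<noteq> 0 \<and> proj z = p"
proof -
  have "proj_rel (rep_cp2 p) (rep_cp2 p)" and "proj (rep_cp2 p) = p"
    using Quotient3_rep_reflp[OF Quotient3_cp2] Quotient3_abs_rep[OF Quotient3_cp2]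
    unfolding proj_def by blast+
  then show ?thesis by (auto simp: proj_rel_def)
qed

text \<open>Quotient topology.\<close>

instantiation cp2 :: topological_space
begin

definition open_cp2 :: "cp2 set \<Rightarrow> bool" where
  "open_cp2 U \<longleftrightarrow> open {z. z \<noteq> 0 \<and> proj z \<in> U}"

instance
proof
  have "{z. z \<noteq> 0 \<and> proj z \<in> UNIV} = - {0}" by auto
  then show "open (UNIV :: cp2 set)"
    unfolding open_cp2_def by (simp add: open_delete Compl_eq_Diff_UNIV)
next
  fix S T :: "cp2 set"
  assume "open S" "open T"
  moreover have "{z. z \<noteq> 0 \<and> proj z \<in> S \<inter> T} =
      {z. z \<noteq> 0 \<and> proj z \<in> S} \<inter> {z. z \<noteq> 0 \<and> proj z \<in> T}" by auto
  ultimately show "open (S \<inter> T)"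
    unfolding open_cp2_def by (simp add: open_Int)
next
  fix K :: "cp2 set set"
  assume "\<forall>S\<in>K. open S"
  moreover have "{z. z \<noteq> 0 \<and> proj z \<in> \<Union>K} = (\<Union>S\<in>K. {z. z \<noteq> 0 \<and> proj z \<in> S})" by auto
  ultimately show "open (\<Union>K)"
    unfolding open_cp2_def by auto
qed

end

text \<open>The affine charts. Addition in the index type \<open>3\<close> is cyclic, so \<open>affine_chart j\<close> divides the
  two homogeneous coordinates other than the \<open>j\<close>-th by the \<open>j\<close>-th one.\<close>

lift_definition affine_chart :: "3 \<Rightarrow> cp2 \<Rightarrow> complex \<times> complex"
  is "\<lambda>j z. (z $ (j + 1) / z $ j, z $ (j + 2) / z $ j)"
  by (auto simp: proj_rel_def)

lift_definition in_affine_dom :: "3 \<Rightarrow> cp2 \<Rightarrow> bool"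
  is "\<lambda>j z. z $ j \<noteq> 0"
  by (auto simp: proj_rel_def)

definition affine_dom :: "3 \<Rightarrow> cp2 set" where
  "affine_dom j = {p. in_affine_dom j p}"

lemma affine_chart_proj:
  "z \<noteq> 0 \<Longrightarrow> affine_chart j (proj z) = (z $ (j + 1) / z $ j, z $ (j + 2) / z $ j)"
  unfolding proj_def
  by (rule affine_chart.abs_eq) (auto simp: proj_rel_def intro!: exI[of _ 1])

lemma proj_in_affine_dom: "z \<noteq> 0 \<Longrightarrow> proj z \<in> affine_dom j \<longleftrightarrow> z $ j \<noteq> 0"
  unfolding proj_def affine_dom_def mem_Collect_eq
  by (rule in_affine_dom.abs_eq) (auto simp: proj_rel_def intro!: exI[of _ 1])

text \<open>\<open>smooth_chart U \<phi>\<close>: \<open>(U, \<phi>)\<close> belongs to the maximal smooth atlas (of real dimension 4)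
  generated by the affine charts.\<close>

definition smooth_chart :: "cp2 set \<Rightarrow> (cp2 \<Rightarrow> complex \<times> complex) \<Rightarrow> bool" where
  "smooth_chart U \<phi> \<longleftrightarrow>
     open U \<and> open (\<phi> ` U) \<and> homeomorphism U (\<phi> ` U) \<phi> (inv_into U \<phi>) \<and>
     (\<forall>j. smooth_on (affine_chart j ` (U \<inter> affine_dom j))
            (\<phi> \<circ> inv_into (affine_dom j) (affine_chart j)) \<and>
          smooth_on (\<phi> ` (U \<inter> affine_dom j)) (affine_chart j \<circ> inv_into U \<phi>))"

text \<open>Slice charts; the model slice may be any \<open>k\<close>-dimensional real subspace \<open>S\<close> of
  \<open>complex \<times> complex\<close>, since a real linear change of coordinates moves it to a coordinate one.\<close>

definition embedded_submanifold :: "nat \<Rightarrow> cp2 set \<Rightarrow> bool" where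
  "embedded_submanifold k M \<longleftrightarrow>
     (\<forall>p\<in>M. \<exists>U \<phi> S. p \<in> U \<and> smooth_chart U \<phi> \<and> subspace S \<and> dim S = k \<and>
        \<phi> ` (U \<inter> M) = \<phi> ` U \<inter> S)"


section \<open>Tangent vectors\<close>

text \<open>A tangent vector at \<open>p\<close> is represented by the family of its coordinate expressions in those
  affine charts whose domain contains \<open>p\<close>, the remaining entries being \<open>0\<close>.\<close>

type_synonym tangent = "(complex \<times> complex) ^ 3"

definition smooth_curve_at_0 :: "(real \<Rightarrow> cp2) \<Rightarrow> bool" where
  "smooth_curve_at_0 \<gamma> \<longleftrightarrow>
     (\<exists>\<epsilon>>0. continuous_on {-\<epsilon><..<\<epsilon>} \<gamma> \<and>
        (\<forall>j. smooth_on ({-\<epsilon><..<\<epsilon>} \<inter> \<gamma> -` affine_dom j) (affine_chart j \<circ> \<gamma>)))"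

definition velocity :: "(real \<Rightarrow> cp2) \<Rightarrow> tangent" where
  "velocity \<gamma> = (\<chi> j. if \<gamma> 0 \<in> affine_dom j
                      then vector_derivative (affine_chart j \<circ> \<gamma>) (at 0) else 0)"

definition tangent_space :: "cp2 set \<Rightarrow> cp2 \<Rightarrow> tangent set" where
  "tangent_space M p =
     {velocity \<gamma> | \<gamma>. smooth_curve_at_0 \<gamma> \<and> \<gamma> 0 = p \<and> (\<forall>t. \<gamma> t \<in> M)}"

text \<open>The differential at \<open>z \<noteq> 0\<close> of the projection \<open>z \<mapsto> [z]\<close>; the differential of its restriction
  to the unit sphere is the restriction to the tangent space of the sphere.\<close>

definition dproj :: "complex ^ 3 \<Rightarrow> complex ^ 3 \<Rightarrow> tangent" where
  "dproj z u = (\<chi> j. if proj z \<in> affine_dom j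
                     then frechet_derivative (affine_chart j \<circ> proj) (at z) u else 0)"


section \<open>The Fubini-Study form by symplectic reduction\<close>

text \<open>\<open>(i/2) \<Sum>\<^sub>j du\<^sub>j \<and> d\<bar>u\<^sub>j\<close>, with \<open>(\<alpha> \<and> \<beta>)(u, v) = \<alpha>(u) \<beta>(v) - \<alpha>(v) \<beta>(u)\<close>; the value is real,
  so \<open>Re\<close> only changes the type.\<close>

definition omega_std :: "complex ^ 3 \<Rightarrow> complex ^ 3 \<Rightarrow> real" where
  "omega_std u v = Re (\<i> / 2 * (\<Sum>j\<in>UNIV. u $ j * cnj (v $ j) - v $ j * cnj (u $ j)))"

text \<open>\<open>inner\<close> on \<open>complex ^ 3\<close> is the real part of the Hermitian product, so this is the real
  tangent space of the unit sphere.\<close>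

definition sphere_tangent :: "complex ^ 3 \<Rightarrow> (complex ^ 3) set" where
  "sphere_tangent z = {u. u \<bullet> z = 0}"

text \<open>The form whose pullback along the projection from the unit sphere is the restriction of
  \<open>omega_std\<close>; that the description is well defined is \<open>fubini_study_pullback\<close> below.\<close>

definition fubini_study :: "cp2 \<Rightarrow> tangent \<Rightarrow> tangent \<Rightarrow> real" where
  "fubini_study p \<xi> \<eta> =
     (THE r. \<exists>z u v. norm z = 1 \<and> proj z = p \<and> u \<in> sphere_tangent z \<and> v \<in> sphere_tangent z \<and>
        dproj z u = \<xi> \<and> dproj z v = \<eta> \<and> r = omega_std u v)"

definition herm :: "complex ^ 3 \<Rightarrow> complex ^ 3 \<Rightarrow> complex" where
  "herm u v = (\<Sum>j\<in>UNIV. u $ j * cnj (v $ j))"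

lemma omega_std_herm: "omega_std u v = - Im (herm u v)"
  by (simp add: omega_std_def herm_def sum_3)

lemma inner_herm: "u \<bullet> v = Re (herm u v)"
  by (simp add: inner_vec_def herm_def sum_3 inner_complex_def)

lemma dproj_component:
  assumes "z $ j \<noteq> 0"
  shows "dproj z u $ j =
    ((u $ (j + 1) * z $ j - z $ (j + 1) * u $ j) / (z $ j)\<^sup>2,
     (u $ (j + 2) * z $ j - z $ (j + 2) * u $ j) / (z $ j)\<^sup>2)"
proof -
  have z: "z \<noteq> 0" using assms by auto
  have q: "((\<lambda>w. w $ k / w $ j) has_derivative
      (\<lambda>u. (u $ k * z $ j - z $ k * u $ j) / (z $ j)\<^sup>2)) (at z)" for k :: 3
  proof -
    have "((\<lambda>w. w $ i) has_derivative (\<lambda>u. u $ i)) (at z)" for i :: 3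
      by (rule bounded_linear_imp_has_derivative) (rule bounded_linear_vec_nth)
    from has_derivative_divide'[OF this this, of j k] show ?thesis
      using assms by (simp add: power2_eq_square)
  qed
  let ?D = "\<lambda>u. ((u $ (j + 1) * z $ j - z $ (j + 1) * u $ j) / (z $ j)\<^sup>2,
     (u $ (j + 2) * z $ j - z $ (j + 2) * u $ j) / (z $ j)\<^sup>2)"
  have "((\<lambda>w. (w $ (j + 1) / w $ j, w $ (j + 2) / w $ j)) has_derivative ?D) (at z)"
    by (intro has_derivative_Pair q)
  then have "(affine_chart j \<circ> proj has_derivative ?D) (at z)"
    by (rule has_derivative_transform_within_open[where s = "UNIV - {0}"])
       (use z in \<open>auto simp: affine_chart_proj intro: open_delete\<close>)
  then have "frechet_derivative (affine_chart j \<circ> proj) (at z) = ?D"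
    by (rule frechet_derivative_at[symmetric])
  then show ?thesis
    using assms z by (simp add: dproj_def proj_in_affine_dom)
qed

lemma dproj_eqD:
  assumes "z \<noteq> 0" "c \<noteq> 0" "dproj (c *s z) u' = dproj z u"
  shows "\<exists>\<mu>. u' = c *s (u - \<mu> *s z)"
proof -
  obtain j where j: "z $ j \<noteq> 0" using assms(1) by (auto simp: vec_eq_iff)
  have cj: "(c *s z) $ j \<noteq> 0" using j assms(2) by simp
  define m where "m = (u $ j - u' $ j / c) / z $ j"
  have "m * z $ j = u $ j - u' $ j / c" using j by (simp add: m_def)
  then have mj: "c * u $ j - u' $ j = c * (m * z $ j)"
    using assms(2) by (simp add: right_diff_distrib)
  have key: "u' $ k = c * (u $ k - m * z $ k)"
    if "(u' $ k * (c * z $ j) - c * z $ k * u' $ j) / (c * z $ j)\<^sup>2 =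
        (u $ k * z $ j - z $ k * u $ j) / (z $ j)\<^sup>2" for k
  proof -
    have cancel: "P = c * Q" if "c * P / (c * b)\<^sup>2 = Q / b\<^sup>2" "b \<noteq> 0" for P Q b :: complex
      using that assms(2) by (simp add: divide_simps power2_eq_square)
    have "u' $ k * (c * z $ j) - c * z $ k * u' $ j = c * (u' $ k * z $ j - z $ k * u' $ j)"
      by (simp add: algebra_simps)
    then have "u' $ k * z $ j - z $ k * u' $ j = c * (u $ k * z $ j - z $ k * u $ j)"
      using that j by (intro cancel[of _ "z $ j"]) simp_all
    then have "u' $ k * z $ j = c * u $ k * z $ j - z $ k * (c * u $ j - u' $ j)"
      by (simp add: algebra_simps)
    also have "c * u $ j - u' $ j = c * (m * z $ j)" by (rule mj)
    finally have "u' $ k * z $ j = c * (u $ k - m * z $ k) * z $ j"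
      by (simp add: algebra_simps)
    then show ?thesis using j by simp
  qed
  have "u' $ (j + 1) = c * (u $ (j + 1) - m * z $ (j + 1))"
    by (rule key) (use assms(3) dproj_component[OF cj, of u'] dproj_component[OF j, of u] in simp)
  moreover have "u' $ (j + 2) = c * (u $ (j + 2) - m * z $ (j + 2))"
    by (rule key) (use assms(3) dproj_component[OF cj, of u'] dproj_component[OF j, of u] in simp)
  moreover have "u' $ j = c * (u $ j - m * z $ j)"
    using mj by (simp add: right_diff_distrib diff_eq_eq)
  moreover have "k = j \<or> k = j + 1 \<or> k = j + 2" for k :: 3
    using exhaust_3[of j] exhaust_3[of k] by auto
  ultimately have "u' $ k = c * (u $ k - m * z $ k)" for k
    by (cases "k = j"; cases "k = j + 1") auto
  then show ?thesis
    by (intro exI[of _ m]) (simp add: vec_eq_iff right_diff_distrib mult.assoc)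
qed

lemma fubini_study_pullback:
  assumes "norm z = 1" "u \<in> sphere_tangent z" "v \<in> sphere_tangent z"
  shows "fubini_study (proj z) (dproj z u) (dproj z v) = omega_std u v"
  unfolding fubini_study_def
proof (rule the_equality)
  show "\<exists>z' u' v'. norm z' = 1 \<and> proj z' = proj z \<and>
      u' \<in> sphere_tangent z' \<and> v' \<in> sphere_tangent z' \<and>
      dproj z' u' = dproj z u \<and> dproj z' v' = dproj z v \<and> omega_std u v = omega_std u' v'"
    using assms by blast
next
  fix r
  assume "\<exists>z' u' v'. norm z' = 1 \<and> proj z' = proj z \<and>
      u' \<in> sphere_tangent z' \<and> v' \<in> sphere_tangent z' \<and>
      dproj z' u' = dproj z u \<and> dproj z' v' = dproj z v \<and> r = omega_std u' v'"
  then obtain z' u' v' where a: "norm z' = 1" "proj z' = proj z"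
      "u' \<in> sphere_tangent z'" "v' \<in> sphere_tangent z'"
      "dproj z' u' = dproj z u" "dproj z' v' = dproj z v" "r = omega_std u' v'" by blast
  have nz: "z \<noteq> 0" "z' \<noteq> 0" using assms(1) a(1) by auto
  then obtain c where c: "z' = c *s z"
    using proj_eq_iff[of z z'] a(2) by auto
  have hz: "herm z z = 1"
  proof -
    have "Re (herm z z) = 1" using assms(1) inner_herm[of z z] by (simp add: norm_eq_1)
    moreover have "Im (herm z z) = 0" by (simp add: herm_def sum_3)
    ultimately show ?thesis by (simp add: complex_eq_iff)
  qed
  have sc: "herm (c *s x) (c *s y) = (c * cnj c) * herm x y" for x y
    by (simp add: herm_def sum_3 algebra_simps)
  have "Re (herm z' z') = 1" using a(1) inner_herm[of z' z'] by (simp add: norm_eq_1)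
  then have "Re (c * cnj c) = 1" using sc[of z z] c hz by simp
  then have cc: "c * cnj c = 1" by (simp add: complex_eq_iff)
  then have c0: "c \<noteq> 0" by auto
  obtain m where m: "u' = c *s (u - m *s z)"
    using dproj_eqD[OF nz(1) c0, of u' u] a(5) c by auto
  obtain n where n: "v' = c *s (v - n *s z)"
    using dproj_eqD[OF nz(1) c0, of v' v] a(6) c by auto
  have lin: "herm (x - s *s z) (y - t *s z) =
      herm x y - cnj t * herm x z - s * herm z y + s * cnj t * herm z z" for x y s t
    by (simp add: herm_def sum_3 algebra_simps)
  have conj: "herm z x = cnj (herm x z)" for x
    by (simp add: herm_def sum_3 algebra_simps)
  have tu: "Re (herm u z) = 0" and tv: "Re (herm v z) = 0"
    using assms(2,3) by (simp_all add: sphere_tangent_def inner_herm)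
  have tm: "Re s = 0" if "c *s (x - s *s z) \<in> sphere_tangent z'" "Re (herm x z) = 0" for x s
  proof -
    have "Re (herm (x - s *s z) z) = 0"
      using that(1) unfolding sphere_tangent_def mem_Collect_eq inner_herm c sc cc by simp
    moreover have "herm (x - s *s z) z = herm x z - s"
      using lin[of x s z 0] hz by simp
    ultimately show ?thesis using that(2) by simp
  qed
  have "Re m = 0" "Re n = 0" using tm a(3,4) m n tu tv by auto
  then have "Im (herm u' v') = Im (herm u v)"
    using tu tv unfolding m n sc cc lin hz conj[of v] by simp
  then show "r = omega_std u v"
    by (simp add: a(7) omega_std_herm)
qed


section \<open>Lagrangian submanifolds\<close>

definition lagrangian :: "(cp2 \<Rightarrow> tangent \<Rightarrow> tangent \<Rightarrow> real) \<Rightarrow> cp2 set \<Rightarrow> bool" where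
  "lagrangian \<omega> M \<longleftrightarrow> embedded_submanifold 2 M \<and>
     (\<forall>p\<in>M. \<forall>\<xi>\<in>tangent_space M p. \<forall>\<eta>\<in>tangent_space M p. \<omega> p \<xi> \<eta> = 0)"

definition L2 :: "cp2 set" where
  "L2 = {hpoint ((cnj \<alpha>)\<^sup>2 + (cnj \<beta>)\<^sup>2)
                (complex_of_real (sqrt 2) * (cnj \<alpha> * \<beta> - \<alpha> * cnj \<beta>))
                (\<alpha>\<^sup>2 + \<beta>\<^sup>2) | \<alpha> \<beta>. (cmod \<alpha>)\<^sup>2 + (cmod \<beta>)\<^sup>2 = 1}"

lemma L2_coordinates_nonzero:
  assumes "(cmod \<alpha>)\<^sup>2 + (cmod \<beta>)\<^sup>2 = 1"
  shows "vector [(cnj \<alpha>)\<^sup>2 + (cnj \<beta>)\<^sup>2,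
           complex_of_real (sqrt 2) * (cnj \<alpha> * \<beta> - \<alpha> * cnj \<beta>), \<alpha>\<^sup>2 + \<beta>\<^sup>2]
         \<noteq> (0 :: complex ^ 3)"
proof
  assume "vector [(cnj \<alpha>)\<^sup>2 + (cnj \<beta>)\<^sup>2,
           complex_of_real (sqrt 2) * (cnj \<alpha> * \<beta> - \<alpha> * cnj \<beta>), \<alpha>\<^sup>2 + \<beta>\<^sup>2]
         = (0 :: complex ^ 3)"
  then have 1: "cnj \<alpha> * \<beta> = \<alpha> * cnj \<beta>" and 2: "\<alpha>\<^sup>2 + \<beta>\<^sup>2 = 0"
    by (auto simp: vec_eq_iff forall_3)
  have "complex_of_real ((cmod \<alpha>)\<^sup>2 + (cmod \<beta>)\<^sup>2) = 1" using assms by simp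
  then have 3: "\<alpha> * cnj \<alpha> + \<beta> * cnj \<beta> = 1"
    unfolding of_real_add complex_norm_square .
  have "\<alpha> * (\<alpha> * cnj \<alpha> + \<beta> * cnj \<beta>) = cnj \<alpha> * (\<alpha>\<^sup>2 + \<beta>\<^sup>2) + \<beta> * (\<alpha> * cnj \<beta> - cnj \<alpha> * \<beta>)"
    by (simp add: algebra_simps power2_eq_square)
  then have "\<alpha> = 0" using 1 2 3 by simp
  then show False using 2 3 by simp
qed

end

theory Submission
  imports Defs
begin

text \<open>
  \<open>L2\<close> is the image in the projective plane of the nonzero vectors of the real form
  \<open>V = {z. z\<^sub>0 = cnj z\<^sub>2 \<and> Re z\<^sub>1 = 0}\<close> of \<open>\<complex>\<^sup>3\<close>, that is, the image of the standard \<open>\<real>P\<^sup>2\<close> under a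
  projective transformation. The affine charts composed with this transformation belong to the
  smooth atlas, the transition maps being rational, and they straighten the submanifold to
  \<open>\<real> \<times> \<real>\<close>. A curve in the submanifold lifts near its initial point to a differentiable curve in \<open>V\<close>,
  so every tangent vector is the image of a vector of \<open>V\<close>, and the Hermitian product is real on \<open>V\<close>.
\<close>

section \<open>Differentiability and rational maps\<close>

text \<open>A class closed under directional derivatives, so that one induction gives smoothness of
  every order. The rule \<open>linear\<close> asks for real linearity only. Values are single
  complex numbers because \<open>mult\<close> and \<open>inverse\<close> need a field; pairs are
  handled componentwise.\<close>

inductive rational_on :: "'a::euclidean_space set \<Rightarrow> ('a \<Rightarrow> complex) \<Rightarrow> bool" for S where
  const: "rational_on S (\<lambda>_. c)"
| linear: "bounded_linear f \<Longrightarrow> rational_on S f"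
| add: "rational_on S f \<Longrightarrow> rational_on S g \<Longrightarrow> rational_on S (\<lambda>x. f x + g x)"
| mult: "rational_on S f \<Longrightarrow> rational_on S g \<Longrightarrow> rational_on S (\<lambda>x. f x * g x)"
| inverse: "rational_on S f \<Longrightarrow> (\<And>x. x \<in> S \<Longrightarrow> f x \<noteq> 0) \<Longrightarrow> rational_on S (\<lambda>x. inverse (f x))"

lemma rational_on_minus: "rational_on S f \<Longrightarrow> rational_on S (\<lambda>x. - f x)"
  using rational_on.mult[OF rational_on.const[of S "-1"]] by fastforce

lemma rational_on_divide:
  "rational_on S f \<Longrightarrow> rational_on S g \<Longrightarrow> (\<And>x. x \<in> S \<Longrightarrow> g x \<noteq> 0) \<Longrightarrow>
    rational_on S (\<lambda>x. f x / g x)"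
  unfolding divide_inverse by (intro rational_on.mult rational_on.inverse)

text \<open>Sum, product and inverse rules, rule by rule. The derivatives are delivered as one
  family \<open>D\<close> so that \<open>D x v\<close>, as a function of \<open>x\<close>, is seen
  to lie in the class again.\<close>

lemma rational_on_derivative:
  assumes "rational_on S f"
  shows "\<exists>D. (\<forall>x\<in>S. (f has_derivative D x) (at x)) \<and> (\<forall>v. rational_on S (\<lambda>x. D x v))"
  using assms
proof induction
  case (const c)
  show ?case
    by (intro exI[of _ "\<lambda>_ _. 0"]) (auto intro: rational_on.const)
next
  case (linear f)
  then show ?case
    by (intro exI[of _ "\<lambda>_. f"])
       (auto intro: rational_on.const bounded_linear_imp_has_derivative)
next
  case (add f g)
  then obtain D E where
    "\<forall>x\<in>S. (f has_derivative D x) (at x)" "\<forall>v. rational_on S (\<lambda>x. D x v)"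
    "\<forall>x\<in>S. (g has_derivative E x) (at x)" "\<forall>v. rational_on S (\<lambda>x. E x v)" by blast
  then show ?case
    by (intro exI[of _ "\<lambda>x v. D x v + E x v"]) (auto intro: rational_on.add has_derivative_add)
next
  case (mult f g)
  then obtain D E where
    "\<forall>x\<in>S. (f has_derivative D x) (at x)" "\<forall>v. rational_on S (\<lambda>x. D x v)"
    "\<forall>x\<in>S. (g has_derivative E x) (at x)" "\<forall>v. rational_on S (\<lambda>x. E x v)" by blast
  with mult.hyps show ?case
    by (intro exI[of _ "\<lambda>x v. f x * E x v + D x v * g x"])
       (auto intro!: rational_on.add rational_on.mult has_derivative_mult)
next
  case (inverse f)
  then obtain D where
    "\<forall>x\<in>S. (f has_derivative D x) (at x)" "\<forall>v. rational_on S (\<lambda>x. D x v)" by blast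
  with inverse.hyps show ?case
    by (intro exI[of _ "\<lambda>x v. - (inverse (f x) * D x v * inverse (f x))"])
       (auto intro!: rational_on_minus rational_on.mult rational_on.inverse has_derivative_inverse)
qed

lemma continuous_on_rational_on: "rational_on S f \<Longrightarrow> continuous_on S f"
  using rational_on_derivative
  by (metis continuous_at_imp_continuous_on has_derivative_continuous)

text \<open>The hypothesis on \<open>h\<close> is agreement on \<open>S\<close> only, since
  \<open>frechet_derivative\<close> is known to equal the formal derivative only there. This form
  passes to directional derivatives because \<open>S\<close> is open.\<close>

lemma rational_on_imp_smooth_on:
  fixes h :: "'a::euclidean_space \<Rightarrow> complex \<times> complex"
  assumes S: "open S" and "rational_on S f" "rational_on S g"
    and "\<And>x. x \<in> S \<Longrightarrow> h x = (f x, g x)"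
  shows "smooth_on S h"
proof -
  have "Ck_on n S h" for n
    using assms(2-)
  proof (induction n arbitrary: f g h)
    case (0 f g h)
    then have "continuous_on S (\<lambda>x. (f x, g x))"
      by (intro continuous_on_Pair continuous_on_rational_on)
    with 0 show ?case by (simp cong: continuous_on_cong)
  next
    case (Suc n f g h)
    obtain D E where D: "\<forall>x\<in>S. (f has_derivative D x) (at x)" "\<forall>v. rational_on S (\<lambda>x. D x v)"
      and E: "\<forall>x\<in>S. (g has_derivative E x) (at x)" "\<forall>v. rational_on S (\<lambda>x. E x v)"
      using rational_on_derivative Suc.prems by metis
    have h: "(h has_derivative (\<lambda>v. (D x v, E x v))) (at x)" if "x \<in> S" for x
    proof (rule has_derivative_transform_within_open[OF _ S that])
      show "((\<lambda>x. (f x, g x)) has_derivative (\<lambda>v. (D x v, E x v))) (at x)"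
        using D E that by (intro has_derivative_Pair) auto
    qed (simp add: Suc.prems)
    have "Ck_on n S (\<lambda>x. frechet_derivative h (at x) v)" for v
      using D(2) E(2) by (intro Suc.IH[of "\<lambda>x. D x v" "\<lambda>x. E x v"])
        (simp_all add: frechet_derivative_at[OF h, symmetric])
    then show ?case using h by (auto simp: differentiable_def)
  qed
  then show ?thesis by (simp add: smooth_on_def)
qed

lemma of_real_vector_scalar_mult: "of_real c *s z = c *\<^sub>R z" for z :: "'a::real_algebra_1 ^ 'n"
  by (simp add: vec_eq_iff scaleR_conv_of_real[where 'a = 'a])

lemma has_vector_derivative_componentwise:
  fixes f :: "real \<Rightarrow> 'b::euclidean_space ^ 'n"
  assumes "\<And>i. ((\<lambda>t. f t $ i) has_vector_derivative f' $ i) (at a)"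
  shows "(f has_vector_derivative f') (at a)"
proof -
  have "((\<lambda>t. f t \<bullet> b) has_derivative (\<lambda>h. (h *\<^sub>R f') \<bullet> b)) (at a)" if "b \<in> Basis" for b
  proof -
    obtain i c where "b = axis i c" using \<open>b \<in> Basis\<close> by (auto simp: Basis_vec_def)
    then show ?thesis
      using has_derivative_inner_left[OF assms[of i, unfolded has_vector_derivative_def]]
      by (simp add: inner_axis)
  qed
  then show ?thesis
    unfolding has_vector_derivative_def
    by (subst has_derivative_componentwise_within) blast
qed

lemma smooth_on_imp_differentiable: "smooth_on S f \<Longrightarrow> x \<in> S \<Longrightarrow> f differentiable (at x)"
  unfolding smooth_on_def by (metis Ck_on.simps(2))

section \<open>Homogeneous and affine coordinates\<close>

text \<open>The section of \<open>proj\<close> over the \<open>j\<close>-th affine domain that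
  normalises the \<open>j\<close>-th coordinate to 1; the cyclic indexing is that of
  \<open>affine_chart\<close>.\<close>

definition homog :: "3 \<Rightarrow> complex \<times> complex \<Rightarrow> complex ^ 3" where
  "homog j x = (\<chi> i. if i = j then 1 else if i = j + 1 then fst x else snd x)"

lemma three_cases: "(k::3) = j \<or> k = j + 1 \<or> k = j + 2"
  using exhaust_3[of j] exhaust_3[of k] by auto

lemma three_neq: "(j::3) + 1 \<noteq> j" "(j::3) + 2 \<noteq> j" "(j::3) + 2 \<noteq> j + 1"
  using exhaust_3[of j] by auto

lemma homog_nth [simp]:
  "homog j x $ j = 1" "homog j x $ (j + 1) = fst x" "homog j x $ (j + 2) = snd x"
  by (simp_all add: homog_def three_neq)

lemma homog_neq_0 [simp]: "homog j x \<noteq> 0"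
  by (metis homog_nth(1) zero_index zero_neq_one)

lemma affine_chart_homog: "affine_chart j (proj (homog j x)) = x"
  by (simp add: affine_chart_proj)

lemma proj_homog_in_affine_dom: "proj (homog j x) \<in> affine_dom j"
  by (simp add: proj_in_affine_dom)

lemma proj_scale: "z \<noteq> 0 \<Longrightarrow> c \<noteq> 0 \<Longrightarrow> proj (c *s z) = proj z"
  by (subst proj_eq_iff) (auto intro!: exI[of _ "inverse c"] simp: vec_eq_iff)

lemma homog_affine_chart:
  assumes "z $ j \<noteq> 0"
  shows "homog j (affine_chart j (proj z)) = inverse (z $ j) *s z"
proof -
  have "z \<noteq> 0" using assms by auto
  have "homog j (affine_chart j (proj z)) $ i = inverse (z $ j) * z $ i" for i
    using three_cases[of i j] assms by (auto simp: affine_chart_proj \<open>z \<noteq> 0\<close> divide_inverse)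
  then show ?thesis by (simp add: vec_eq_iff)
qed

lemma proj_homog_affine_chart:
  assumes "p \<in> affine_dom j"
  shows "proj (homog j (affine_chart j p)) = p"
proof -
  obtain z where z: "z \<noteq> 0" "p = proj z" using proj_surj by metis
  with assms show ?thesis
    by (simp add: proj_in_affine_dom homog_affine_chart proj_scale)
qed

lemma open_affine_dom: "open (affine_dom j)"
proof -
  have "{z. z \<noteq> 0 \<and> proj z \<in> affine_dom j} = {z. z $ j \<noteq> 0}"
    by (auto simp: proj_in_affine_dom cong: conj_cong)
  moreover have "open {z :: complex ^ 3. z $ j \<noteq> 0}"
    by (intro open_Collect_neq continuous_intros)
  ultimately show ?thesis by (simp add: open_cp2_def)
qed

lemma inv_into_affine_chart: "inv_into (affine_dom j) (affine_chart j) x = proj (homog j x)"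
  by (rule inv_into_f_eq)
     (auto simp: affine_chart_homog proj_homog_in_affine_dom
       intro: inj_on_inverseI[of _ "\<lambda>x. proj (homog j x)"] proj_homog_affine_chart)

lemma sum_3_cyclic: "(\<Sum>k\<in>UNIV. f k) = f j + f (j + 1) + f (j + 2)" for j :: 3
proof -
  have U: "(UNIV :: 3 set) = {j, j + 1, j + 2}" using three_cases by auto
  show ?thesis
    unfolding U using three_neq[of j] by (auto simp: add.assoc)
qed

lemma rational_on_matrix_homog: "rational_on S (\<lambda>x. (M *v homog j x) $ i)"
proof -
  have "(M *v homog j x) $ i = M $ i $ j + M $ i $ (j + 1) * fst x + M $ i $ (j + 2) * snd x" for x
    by (simp add: matrix_vector_mult_def sum_3_cyclic[of _ j])
  then show ?thesis
    by (simp only:) (intro rational_on.add rational_on.mult rational_on.const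
        rational_on.linear[OF bounded_linear_fst] rational_on.linear[OF bounded_linear_snd])
qed

lemma continuous_on_homog: "continuous_on UNIV (homog j)"
proof -
  have "continuous_on UNIV (\<lambda>x. homog j x $ i)" for i
    using continuous_on_rational_on[OF rational_on_matrix_homog[of UNIV "mat 1" j i]] by simp
  then have "continuous_on UNIV (\<lambda>x. \<chi> i. homog j x $ i)"
    by (rule continuous_on_vec_lambda)
  then show ?thesis by simp
qed

text \<open>The coordinates of \<open>M *v homog k x\<close> are affine in \<open>x\<close>, so
  their ratios are rational where the denominator does not vanish. With \<open>M\<close> a matrix or
  its inverse this serves both directions of a change of charts.\<close>

lemma smooth_on_transition:
  fixes M :: "complex ^ 3 ^ 3"
  shows "open {x. (M *v homog k x) $ j \<noteq> 0}"
    "smooth_on {x. (M *v homog k x) $ j \<noteq> 0}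
     (\<lambda>x. ((M *v homog k x) $ (j + 1) / (M *v homog k x) $ j,
           (M *v homog k x) $ (j + 2) / (M *v homog k x) $ j))"
proof -
  show o: "open {x. (M *v homog k x) $ j \<noteq> 0}"
    by (intro open_Collect_neq continuous_on_rational_on rational_on_matrix_homog continuous_on_const)
  show "smooth_on {x. (M *v homog k x) $ j \<noteq> 0}
     (\<lambda>x. ((M *v homog k x) $ (j + 1) / (M *v homog k x) $ j,
           (M *v homog k x) $ (j + 2) / (M *v homog k x) $ j))"
    by (rule rational_on_imp_smooth_on[OF o])
       (auto intro!: rational_on_divide rational_on_matrix_homog)
qed

section \<open>Projective transformations and their charts\<close>

text \<open>A singular \<open>A\<close> would send some nonzero vectors to 0 and not descend to the
  quotient. Choosing a representative makes the map total; independence of the choice is shown for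
  matrices with a left inverse.\<close>

definition proj_map :: "complex ^ 3 ^ 3 \<Rightarrow> cp2 \<Rightarrow> cp2" where
  "proj_map A p = proj (A *v (SOME z. z \<noteq> 0 \<and> proj z = p))"

lemma matrix_inverse_cancel:
  fixes A B :: "complex ^ 3 ^ 3"
  assumes "B ** A = mat 1"
  shows "B *v (A *v z) = z"
  by (simp add: matrix_vector_mul_assoc assms)

lemma matrix_inverse_neq_0:
  fixes A B :: "complex ^ 3 ^ 3"
  assumes "B ** A = mat 1" "z \<noteq> 0"
  shows "A *v z \<noteq> 0"
  using matrix_inverse_cancel[OF assms(1), of z] assms(2) by auto

lemma proj_map_proj:
  assumes BA: "B ** A = mat 1" and z: "z \<noteq> 0"
  shows "proj_map A (proj z) = proj (A *v z)"
proof -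
  define w where "w = (SOME w. w \<noteq> 0 \<and> proj w = proj z)"
  have w: "w \<noteq> 0 \<and> proj w = proj z"
    unfolding w_def by (rule someI[of _ z]) (use z in simp)
  then obtain c where c: "z = c *s w" using proj_eq_iff z by auto
  with z have "c \<noteq> 0" by auto
  then have "proj (A *v z) = proj (A *v w)"
    unfolding c vector_scalar_commute
    using w by (intro proj_scale matrix_inverse_neq_0[OF BA]) auto
  then show ?thesis unfolding proj_map_def w_def by simp
qed

lemma proj_map_inverse:
  assumes "B ** A = mat 1" "A ** B = mat 1"
  shows "proj_map B (proj_map A p) = p"
proof -
  obtain z where "z \<noteq> 0" "p = proj z" using proj_surj by metis
  then show ?thesis
    using assms by (simp add: proj_map_proj matrix_inverse_neq_0 matrix_inverse_cancel)
qed

section \<open>Continuity with respect to the quotient topology\<close>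

lemma continuous_on_proj: "continuous_on (- {0}) proj"
  unfolding continuous_on_open_vimage[OF open_Compl[OF closed_singleton]]
proof safe
  fix T :: "cp2 set" assume "open T"
  then have "open {z. z \<noteq> 0 \<and> proj z \<in> T}" by (simp add: open_cp2_def)
  moreover have "{z. z \<noteq> 0 \<and> proj z \<in> T} = proj -` T \<inter> - {0}" by auto
  ultimately show "open (proj -` T \<inter> - {0})" by simp
qed

text \<open>The universal property of the quotient topology, localised to an open set.\<close>

lemma continuous_on_cp2:
  assumes U: "open U" and "continuous_on {z. z \<noteq> 0 \<and> proj z \<in> U} (f \<circ> proj)"
  shows "continuous_on U f"
  unfolding continuous_on_open_vimage[OF U]
proof safe
  fix T :: "'a set" assume "open T"
  moreover have "open {z. z \<noteq> 0 \<and> proj z \<in> U}" using U by (simp add: open_cp2_def)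
  ultimately have "open ((f \<circ> proj) -` T \<inter> {z. z \<noteq> 0 \<and> proj z \<in> U})"
    using assms(2) continuous_on_open_vimage by blast
  moreover have "(f \<circ> proj) -` T \<inter> {z. z \<noteq> 0 \<and> proj z \<in> U} =
      {z. z \<noteq> 0 \<and> proj z \<in> f -` T \<inter> U}" by auto
  ultimately show "open (f -` T \<inter> U)" by (simp add: open_cp2_def)
qed

section \<open>Affine charts composed with a projective transformation\<close>

locale projective_transformation =
  fixes A B :: "complex ^ 3 ^ 3"
  assumes AB: "A ** B = mat 1" and BA: "B ** A = mat 1"
begin

definition dom :: "3 \<Rightarrow> cp2 set" where
  "dom k = proj_map A -` affine_dom k"

definition chart :: "3 \<Rightarrow> cp2 \<Rightarrow> complex \<times> complex" where
  "chart k = affine_chart k \<circ> proj_map A"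

lemma proj_in_dom: "z \<noteq> 0 \<Longrightarrow> proj z \<in> dom k \<longleftrightarrow> (A *v z) $ k \<noteq> 0"
  by (simp add: dom_def proj_map_proj[OF BA] proj_in_affine_dom matrix_inverse_neq_0[OF BA])

lemma chart_proj:
  "z \<noteq> 0 \<Longrightarrow>
    chart k (proj z) = ((A *v z) $ (k + 1) / (A *v z) $ k, (A *v z) $ (k + 2) / (A *v z) $ k)"
  by (simp add: chart_def proj_map_proj[OF BA] affine_chart_proj matrix_inverse_neq_0[OF BA])

lemma inverse_in_dom: "proj (B *v homog k x) \<in> dom k"
  by (simp add: proj_in_dom matrix_inverse_neq_0[OF AB] matrix_inverse_cancel[OF AB])

lemma chart_inverse: "chart k (proj (B *v homog k x)) = x"
  by (simp add: chart_proj matrix_inverse_neq_0[OF AB] matrix_inverse_cancel[OF AB])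

lemma inverse_chart:
  assumes "p \<in> dom k"
  shows "proj (B *v homog k (chart k p)) = p"
proof -
  have "proj (B *v homog k (chart k p)) = proj_map B (proj (homog k (chart k p)))"
    by (simp add: proj_map_proj[OF AB])
  also have "\<dots> = proj_map B (proj_map A p)"
    using assms by (simp add: chart_def dom_def proj_homog_affine_chart)
  finally show ?thesis by (simp add: proj_map_inverse AB BA)
qed

lemma chart_image: "chart k ` dom k = UNIV"
  using chart_inverse inverse_in_dom by (metis UNIV_eq_I imageI)

lemma inv_into_chart: "inv_into (dom k) (chart k) x = proj (B *v homog k x)"
  by (rule inv_into_f_eq)
     (auto simp: chart_inverse inverse_in_dom
       intro: inj_on_inverseI[of _ "\<lambda>x. proj (B *v homog k x)"] inverse_chart)

lemma open_dom: "open (dom k)"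
proof -
  have "{z. z \<noteq> 0 \<and> proj z \<in> dom k} = {z. (A *v z) $ k \<noteq> 0}"
    by (auto simp: proj_in_dom cong: conj_cong)
  moreover have "open {z. (A *v z) $ k \<noteq> 0}"
    by (intro open_Collect_neq continuous_intros linear_continuous_on) simp
  ultimately show ?thesis by (simp add: open_cp2_def)
qed

lemma homeomorphism_chart:
  "homeomorphism (dom k) (chart k ` dom k) (chart k) (inv_into (dom k) (chart k))"
proof (rule homeomorphismI)
  have "continuous_on {z. z \<noteq> 0 \<and> proj z \<in> dom k}
      (\<lambda>z. ((A *v z) $ (k + 1) / (A *v z) $ k, (A *v z) $ (k + 2) / (A *v z) $ k))"
    by (intro continuous_intros linear_continuous_on) (auto simp: proj_in_dom)
  then have "continuous_on {z. z \<noteq> 0 \<and> proj z \<in> dom k} (chart k \<circ> proj)"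
    by (rule continuous_on_eq) (simp add: chart_proj)
  then show "continuous_on (dom k) (chart k)"
    by (rule continuous_on_cp2[OF open_dom])
  have "continuous_on UNIV (\<lambda>x. proj (B *v homog k x))"
    by (rule continuous_on_compose2[OF continuous_on_proj])
       (auto simp: matrix_inverse_neq_0[OF AB]
         intro!: continuous_on_compose2[OF linear_continuous_on continuous_on_homog])
  then show "continuous_on (chart k ` dom k) (inv_into (dom k) (chart k))"
    by (simp add: inv_into_chart[abs_def] chart_image)
qed (auto simp: inv_into_chart chart_inverse inverse_chart inverse_in_dom)

text \<open>In coordinates the two transition maps are the ratios of
  \<open>smooth_on_transition\<close>, for the matrix \<open>A\<close> in one direction and
  \<open>B\<close> in the other.\<close>

lemma smooth_chart_chart: "smooth_chart (dom k) (chart k)"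
  unfolding smooth_chart_def
proof (intro conjI allI)
  fix j
  have 1: "affine_chart j ` (dom k \<inter> affine_dom j) = {x. (A *v homog j x) $ k \<noteq> 0}"
  proof (intro equalityI subsetI)
    fix x assume "x \<in> affine_chart j ` (dom k \<inter> affine_dom j)"
    then obtain p where p: "p \<in> dom k" "p \<in> affine_dom j" "x = affine_chart j p" by auto
    then show "x \<in> {x. (A *v homog j x) $ k \<noteq> 0}"
      using proj_in_dom[of "homog j x" k] by (simp add: proj_homog_affine_chart)
  next
    fix x assume "x \<in> {x. (A *v homog j x) $ k \<noteq> 0}"
    then show "x \<in> affine_chart j ` (dom k \<inter> affine_dom j)"
      by (intro image_eqI[of _ _ "proj (homog j x)"])
         (auto simp: proj_in_dom affine_chart_homog proj_homog_in_affine_dom)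
  qed
  show "smooth_on (affine_chart j ` (dom k \<inter> affine_dom j))
      (chart k \<circ> inv_into (affine_dom j) (affine_chart j))"
    unfolding 1 using smooth_on_transition(2)[of A j k]
    by (simp add: comp_def inv_into_affine_chart chart_proj)
  have 2: "chart k ` (dom k \<inter> affine_dom j) = {x. (B *v homog k x) $ j \<noteq> 0}"
  proof (intro equalityI subsetI)
    fix x assume "x \<in> chart k ` (dom k \<inter> affine_dom j)"
    then obtain p where p: "p \<in> dom k" "p \<in> affine_dom j" "x = chart k p" by auto
    then show "x \<in> {x. (B *v homog k x) $ j \<noteq> 0}"
      using proj_in_affine_dom[of "B *v homog k x" j]
      by (simp add: inverse_chart matrix_inverse_neq_0[OF AB])
  next
    fix x assume "x \<in> {x. (B *v homog k x) $ j \<noteq> 0}"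
    then show "x \<in> chart k ` (dom k \<inter> affine_dom j)"
      by (intro image_eqI[of _ _ "proj (B *v homog k x)"])
         (auto simp: proj_in_affine_dom inverse_in_dom chart_inverse matrix_inverse_neq_0[OF AB])
  qed
  show "smooth_on (chart k ` (dom k \<inter> affine_dom j))
      (affine_chart j \<circ> inv_into (dom k) (chart k))"
    unfolding 2 using smooth_on_transition(2)[of B k j]
    by (simp add: comp_def inv_into_chart affine_chart_proj matrix_inverse_neq_0[OF AB])
qed (use homeomorphism_chart in \<open>auto simp: open_dom chart_image\<close>)

end

section \<open>Tangent vectors of lifted curves\<close>

lemma dproj_component_0: "z \<noteq> 0 \<Longrightarrow> z $ j = 0 \<Longrightarrow> dproj z u $ j = 0"
  by (simp add: dproj_def proj_in_affine_dom)

text \<open>The complex line through \<open>z\<close> is collapsed by the projection. This allows a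
  lift of a tangent vector to be moved into the tangent space of the sphere.\<close>

lemma dproj_add_multiple:
  assumes "z \<noteq> 0"
  shows "dproj z (u + c *s z) = dproj z u"
proof -
  have "dproj z (u + c *s z) $ j = dproj z u $ j" for j
    using assms by (cases "z $ j = 0") (simp_all add: dproj_component_0 dproj_component algebra_simps)
  then show ?thesis by (simp add: vec_eq_iff)
qed

text \<open>The chain rule in each affine chart around the base point. The lift is required only
  near 0, where curves in a projective image can be lifted by an explicit formula.\<close>

lemma velocity_proj:
  assumes g: "(g has_vector_derivative u) (at 0)" and z: "g 0 \<noteq> 0"
    and lift: "\<forall>\<^sub>F t in nhds 0. \<gamma> t = proj (g t)"
  shows "velocity \<gamma> = dproj (g 0) u"
proof -
  have \<gamma>0: "\<gamma> 0 = proj (g 0)" using lift by (rule eventually_nhds_x_imp_x)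
  have "velocity \<gamma> $ j = dproj (g 0) u $ j" for j
  proof (cases "g 0 $ j = 0")
    case False
    define D where "D = frechet_derivative (affine_chart j \<circ> proj) (at (g 0))"
    have "(\<lambda>w :: complex ^ 3. w $ i) differentiable at (g 0)" for i
      by (rule bounded_linear_imp_differentiable) (rule bounded_linear_vec_nth)
    then have "(\<lambda>w. (w $ (j + 1) / w $ j, w $ (j + 2) / w $ j)) differentiable at (g 0)"
      using False by (intro differentiable_Pair differentiable_divide) auto
    then have "(affine_chart j \<circ> proj) differentiable at (g 0)"
      \<comment> \<open>The ball of radius \<open>norm (g 0)\<close> around \<open>g 0\<close>
        avoids the origin, where \<open>proj\<close> is not meaningful.\<close>
      by (rule differentiable_transform_within[where d = "norm (g 0)"])
         (use z in \<open>auto intro!: affine_chart_proj[symmetric]\<close>)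
    then have "((affine_chart j \<circ> proj) has_derivative D) (at (g 0))"
      unfolding D_def frechet_derivative_works .
    then have "((affine_chart j \<circ> proj \<circ> g) has_vector_derivative D u) (at 0)"
      using g vector_derivative_diff_chain_within[of g u 0 UNIV "affine_chart j \<circ> proj" D]
      by (simp add: has_derivative_at_withinI)
    then have "((affine_chart j \<circ> \<gamma>) has_vector_derivative D u) (at 0)"
      unfolding has_vector_derivative_def
      by (rule has_derivative_transform_eventually)
         (use lift \<gamma>0 in \<open>auto simp: eventually_at_filter elim: eventually_mono\<close>)
    then show ?thesis
      using z False by (simp add: velocity_def dproj_def \<gamma>0 proj_in_affine_dom D_def vector_derivative_at)
  qed (use z in \<open>simp add: velocity_def dproj_component_0 \<gamma>0 proj_in_affine_dom\<close>)
  then show ?thesis by (simp add: vec_eq_iff)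
qed

section \<open>Projective images of real forms\<close>

definition real_points :: "complex ^ 3 ^ 3 \<Rightarrow> (complex ^ 3) set" where
  "real_points A = {z. \<forall>i. (A *v z) $ i \<in> \<real>}"

lemma real_points_add: "u \<in> real_points A \<Longrightarrow> v \<in> real_points A \<Longrightarrow> u + v \<in> real_points A"
  by (simp add: real_points_def matrix_vector_right_distrib)

lemma real_points_scale: "c \<in> \<real> \<Longrightarrow> u \<in> real_points A \<Longrightarrow> c *s u \<in> real_points A"
  by (simp add: real_points_def vector_scalar_commute)

text \<open>Ratios of real coordinates are real, and a real pair \<open>x\<close> makes
  \<open>homog k x\<close> real. So \<open>chart k\<close> is a slice chart with model slice
  \<open>\<real> \<times> \<real>\<close>.\<close>

lemma (in projective_transformation) embedded_submanifold_real_points: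
  "embedded_submanifold 2 (proj ` (real_points A - {0}))"
  unfolding embedded_submanifold_def
proof
  fix p assume "p \<in> proj ` (real_points A - {0})"
  then obtain z where z: "z \<in> real_points A" "z \<noteq> 0" "p = proj z" by auto
  then obtain k where k: "(A *v z) $ k \<noteq> 0"
    using matrix_inverse_neq_0[OF BA z(2)] by (auto simp: vec_eq_iff)
  have "chart k ` (dom k \<inter> proj ` (real_points A - {0})) = \<real> \<times> \<real>"
  proof (intro equalityI subsetI)
    fix x assume "x \<in> chart k ` (dom k \<inter> proj ` (real_points A - {0}))"
    then obtain w where "w \<noteq> 0" "w \<in> real_points A" "x = chart k (proj w)" by auto
    then show "x \<in> \<real> \<times> \<real>"
      by (simp add: chart_proj real_points_def)
  next
    fix x :: "complex \<times> complex" assume "x \<in> \<real> \<times> \<real>"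
    then have "homog k x $ i \<in> \<real>" for i
      using three_cases[of i k] by (auto simp: mem_Times_iff)
    then have "B *v homog k x \<in> real_points A - {0}"
      by (simp add: real_points_def matrix_inverse_cancel[OF AB] matrix_inverse_neq_0[OF AB])
    then show "x \<in> chart k ` (dom k \<inter> proj ` (real_points A - {0}))"
      by (intro image_eqI[of _ _ "proj (B *v homog k x)"]) (auto simp: inverse_in_dom chart_inverse)
  qed
  moreover have "subspace (\<real> \<times> \<real> :: (complex \<times> complex) set)"
    by (auto simp: subspace_def zero_prod_def complex_is_Real_iff)
  moreover have "dim (\<real> \<times> \<real> :: (complex \<times> complex) set) = 2"
  proof -
    have R: "(\<real> :: complex set) = span {1}"
      by (auto simp: span_singleton Reals_def scaleR_conv_of_real)
    have "dim (\<real> :: complex set) = 1"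
      unfolding R dim_span by (simp add: dim_singleton)
    moreover have "subspace (\<real> :: complex set)" unfolding R by (rule subspace_span)
    ultimately show ?thesis by (simp add: dim_Times)
  qed
  ultimately show "\<exists>U \<phi> S. p \<in> U \<and> smooth_chart U \<phi> \<and> subspace S \<and> dim S = 2 \<and>
      \<phi> ` (U \<inter> proj ` (real_points A - {0})) = \<phi> ` U \<inter> S"
    using smooth_chart_chart[of k] k z
    by (intro exI[of _ "dom k"] exI[of _ "chart k"] exI[of _ "\<real> \<times> \<real>"])
       (simp add: chart_image proj_in_dom)
qed

text \<open>Membership in \<open>real_points A\<close> is the vanishing of the real-linear
  functionals \<open>Im ((A *v z) $ i)\<close>, which can be differentiated along the curve.\<close>

lemma derivative_in_real_points:
  assumes g: "(g has_vector_derivative u) (at a)"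
    and real: "\<forall>\<^sub>F t in nhds a. g t \<in> real_points A"
  shows "u \<in> real_points A"
  unfolding real_points_def
proof safe
  fix i
  have "bounded_linear (\<lambda>z. Im ((A *v z) $ i))"
    by (intro bounded_linear_compose[OF bounded_linear_Im]
        bounded_linear_compose[OF bounded_linear_vec_nth] matrix_vector_mul_bounded_linear)
  then have 1: "((\<lambda>t. Im ((A *v g t) $ i)) has_vector_derivative Im ((A *v u) $ i)) (at a)"
    using g by (rule bounded_linear.has_vector_derivative)
  have "\<forall>\<^sub>F t in nhds a. Im ((A *v g t) $ i) = 0"
    using real by eventually_elim (simp add: real_points_def complex_is_Real_iff)
  then have "((\<lambda>t. 0) has_vector_derivative Im ((A *v u) $ i)) (at a)"
    using 1 unfolding has_vector_derivative_def
    by (elim has_derivative_transform_eventually)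
       (auto simp: eventually_at_filter elim: eventually_mono dest: eventually_nhds_x_imp_x)
  then show "(A *v u) $ i \<in> \<real>"
    using vector_derivative_unique_at[OF _ has_vector_derivative_const]
    by (simp add: complex_is_Real_iff)
qed

text \<open>The affine representative of a point of the curve is a complex multiple of a vector of
  \<open>real_points A\<close>; making the \<open>k\<close>-th coordinate of its image under \<open>A\<close> constant and real fixes the phase.\<close>

lemma (in projective_transformation) tangent_space_real_points:
  assumes z: "z \<in> real_points A" "z \<noteq> 0"
    and \<xi>: "\<xi> \<in> tangent_space (proj ` (real_points A - {0})) (proj z)"
  shows "\<exists>u\<in>real_points A. dproj z u = \<xi>"
proof -
  obtain \<gamma> where \<gamma>: "smooth_curve_at_0 \<gamma>" "\<gamma> 0 = proj z" "\<xi> = velocity \<gamma>"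
    "\<And>t. \<gamma> t \<in> proj ` (real_points A - {0})"
    using \<xi> unfolding tangent_space_def by auto
  obtain j where j: "z $ j \<noteq> 0" using z(2) by (auto simp: vec_eq_iff)
  obtain k where k: "(A *v z) $ k \<noteq> 0"
    using matrix_inverse_neq_0[OF BA z(2)] by (auto simp: vec_eq_iff)
  define x where "x = affine_chart j \<circ> \<gamma>"
  define S where "S = {y. (A *v homog j y) $ k \<noteq> 0}"
  \<comment> \<open>The numerator makes \<open>G (x 0) = z\<close>, so that the derivative of the
    lift is a vector at \<open>z\<close> itself and not at another representative of the
    point.\<close>
  define G where "G y = ((A *v z) $ k / (A *v homog j y) $ k) *s homog j y" for y
  have G: "G (affine_chart j (proj w)) = ((A *v z) $ k / (A *v w) $ k) *s w"
    and in_S: "affine_chart j (proj w) \<in> S \<longleftrightarrow> (A *v w) $ k \<noteq> 0"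
    if "w $ j \<noteq> 0" for w
    using that by (simp_all add: G_def S_def homog_affine_chart vector_scalar_commute vec_eq_iff)
  have x0: "x 0 \<in> S" and Gx0: "G (x 0) = z"
    using in_S[OF j] G[OF j] k by (simp_all add: x_def \<gamma>(2))
  obtain \<epsilon> where "\<epsilon> > 0" and cont: "continuous_on {-\<epsilon><..<\<epsilon>} \<gamma>"
    and smooth: "smooth_on ({-\<epsilon><..<\<epsilon>} \<inter> \<gamma> -` affine_dom j) x"
    using \<gamma>(1) unfolding smooth_curve_at_0_def x_def by blast
  define T where "T = {-\<epsilon><..<\<epsilon>} \<inter> \<gamma> -` affine_dom j"
  have T: "open T" "0 \<in> T"
    using cont open_affine_dom \<open>\<epsilon> > 0\<close> j z(2)
    by (auto simp: T_def \<gamma>(2) proj_in_affine_dom continuous_on_open_vimage Int_commute)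
  have "x differentiable at 0"
    using smooth_on_imp_differentiable[OF smooth] T by (simp add: T_def)
  then obtain d where d: "(x has_vector_derivative d) (at 0)"
    using vector_derivative_works by blast
  have lift: "\<forall>\<^sub>F t in nhds 0. G (x t) \<in> real_points A \<and> \<gamma> t = proj (G (x t))"
  proof -
    have "open S" unfolding S_def by (rule smooth_on_transition(1))
    then have "\<forall>\<^sub>F t in nhds 0. x t \<in> S"
      using x0 has_vector_derivative_continuous[OF d]
      by (intro topological_tendstoD[of x "x 0"])
         (simp_all add: isCont_def tendsto_at_iff_tendsto_nhds)
    moreover have "\<forall>\<^sub>F t in nhds 0. t \<in> T" using T by (rule eventually_nhds_in_open)
    ultimately show ?thesis
    proof eventually_elim
      case (elim t)
      obtain w where w: "w \<in> real_points A" "w \<noteq> 0" "\<gamma> t = proj w" using \<gamma>(4)[of t] by auto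
      then have wj: "w $ j \<noteq> 0" using elim(2) by (simp add: T_def proj_in_affine_dom)
      have "x t = affine_chart j (proj w)" by (simp add: x_def w(3))
      then have wk: "(A *v w) $ k \<noteq> 0" and Gx: "G (x t) = ((A *v z) $ k / (A *v w) $ k) *s w"
        using in_S[OF wj] G[OF wj] elim(1) by simp_all
      \<comment> \<open>Hence \<open>G (x t)\<close> is a real multiple of \<open>w\<close> and
        stays in the real form.\<close>
      have "(A *v z) $ k / (A *v w) $ k \<in> \<real>"
        using z(1) w(1) by (simp add: real_points_def)
      then show ?case
        unfolding Gx using w wk k by (simp add: real_points_scale proj_scale)
    qed
  qed
  have "\<exists>u. ((\<lambda>t. G (x t)) has_vector_derivative u) (at 0)"
  proof -
    have "\<exists>u. ((\<lambda>t. G (x t) $ i) has_vector_derivative u) (at 0)" for i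
    proof -
      have "rational_on S (\<lambda>y. homog j y $ i)"
        using rational_on_matrix_homog[of S "mat 1" j i] by simp
      then have "rational_on S (\<lambda>y. (A *v z) $ k / (A *v homog j y) $ k * homog j y $ i)"
        by (intro rational_on.mult rational_on_divide rational_on.const rational_on_matrix_homog)
           (simp_all add: S_def)
      then obtain D where "((\<lambda>y. G y $ i) has_derivative D) (at (x 0))"
        using rational_on_derivative x0 by (fastforce simp: G_def)
      then have "((\<lambda>y. G y $ i) \<circ> x has_vector_derivative D d) (at 0)"
        using vector_derivative_diff_chain_within[of x d 0 UNIV "\<lambda>y. G y $ i" D] d
        by (simp add: has_derivative_at_withinI)
      then show ?thesis by (auto simp: comp_def)
    qed
    then obtain u where "\<And>i. ((\<lambda>t. G (x t) $ i) has_vector_derivative u i) (at 0)" by metis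
    then show ?thesis
      by (intro exI[of _ "\<chi> i. u i"] has_vector_derivative_componentwise) simp
  qed
  then obtain u where u: "((\<lambda>t. G (x t)) has_vector_derivative u) (at 0)" by blast
  have "u \<in> real_points A"
    using u lift by (intro derivative_in_real_points[OF u]) (auto elim: eventually_mono)
  moreover have "dproj z u = \<xi>"
    using velocity_proj[OF u, of \<gamma>] eventually_mono[OF lift] z(2) by (simp add: \<gamma>(3) Gx0)
  ultimately show ?thesis by blast
qed

lemma (in projective_transformation) lagrangian_real_points:
  assumes omega: "\<And>u v. u \<in> real_points A \<Longrightarrow> v \<in> real_points A \<Longrightarrow> omega_std u v = 0"
  shows "lagrangian fubini_study (proj ` (real_points A - {0}))"
  unfolding lagrangian_def
proof (intro conjI ballI)
  let ?M = "proj ` (real_points A - {0})"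
  show "embedded_submanifold 2 ?M" by (rule embedded_submanifold_real_points)
  fix p \<xi> \<eta> assume p: "p \<in> ?M" and \<xi>: "\<xi> \<in> tangent_space ?M p" and \<eta>: "\<eta> \<in> tangent_space ?M p"
  obtain w where w: "w \<in> real_points A" "w \<noteq> 0" "p = proj w" using p by auto
  \<comment> \<open>A real rescaling reaches the unit sphere without leaving the real form.\<close>
  define z where "z = complex_of_real (1 / norm w) *s w"
  have z: "z \<in> real_points A" "p = proj z"
    using w by (simp_all add: z_def real_points_scale proj_scale)
  have "z = (1 / norm w) *\<^sub>R w"
    unfolding z_def by (rule of_real_vector_scalar_mult)
  then have nz: "norm z = 1" using w(2) by simp
  then have "z \<noteq> 0" by auto
  have sphere: "\<exists>u\<in>real_points A. u \<in> sphere_tangent z \<and> dproj z u = \<zeta>"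
    if \<zeta>: "\<zeta> \<in> tangent_space ?M p" for \<zeta>
  proof -
    obtain u where u: "u \<in> real_points A" "dproj z u = \<zeta>"
      using tangent_space_real_points[OF z(1) \<open>z \<noteq> 0\<close>] \<zeta> z(2) by blast
    \<comment> \<open>This removes the radial component of \<open>u\<close>. As \<open>c\<close> is
      real, the corrected vector is still in \<open>real_points A\<close>, and its image under
      \<open>dproj z\<close> is unchanged.\<close>
    define c where "c = - (u \<bullet> z)"
    have "u + complex_of_real c *s z \<in> sphere_tangent z"
      using nz by (simp add: of_real_vector_scalar_mult sphere_tangent_def inner_diff_left c_def norm_eq_1)
    moreover have "u + complex_of_real c *s z \<in> real_points A"
      using u z by (simp add: real_points_add real_points_scale)
    ultimately show ?thesis
      using u(2) dproj_add_multiple[OF \<open>z \<noteq> 0\<close>] by metis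
  qed
  obtain u v where "u \<in> real_points A" "u \<in> sphere_tangent z" "dproj z u = \<xi>"
    "v \<in> real_points A" "v \<in> sphere_tangent z" "dproj z v = \<eta>"
    using sphere[OF \<xi>] sphere[OF \<eta>] by blast
  then show "fubini_study p \<xi> \<eta> = 0"
    using fubini_study_pullback[OF nz] omega z(2) by metis
qed

section \<open>The submanifold \<open>L2\<close>\<close>

text \<open>The rows are the forms \<open>z $ 1 + z $ 3\<close>, \<open>\<i> * z $ 2\<close> and
  \<open>\<i> * (z $ 1 - z $ 3)\<close>. The first and third are both real exactly when
  \<open>z $ 1\<close> and \<open>z $ 3\<close> are conjugate.\<close>

definition L2_mat :: "complex ^ 3 ^ 3" where
  "L2_mat = vector [vector [1, 0, 1], vector [0, \<i>, 0], vector [\<i>, 0, - \<i>]]"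

definition L2_mat_inv :: "complex ^ 3 ^ 3" where
  "L2_mat_inv = vector [vector [1 / 2, 0, - \<i> / 2], vector [0, - \<i>, 0], vector [1 / 2, 0, \<i> / 2]]"

interpretation L2: projective_transformation L2_mat L2_mat_inv
  by unfold_locales
     (simp_all add: L2_mat_def L2_mat_inv_def matrix_matrix_mult_def mat_def vec_eq_iff forall_3 sum_3)

lemma real_points_L2_mat: "z \<in> real_points L2_mat \<longleftrightarrow> z $ 1 = cnj (z $ 3) \<and> Re (z $ 2) = 0"
  by (auto simp: real_points_def L2_mat_def matrix_vector_mult_def forall_3 sum_3
      complex_is_Real_iff complex_eq_iff)

text \<open>In \<open>herm u v\<close> the first and third summands are conjugate to each other, and
  the second is a product of two imaginary numbers, so the sum is real.\<close>

lemma omega_std_real_points_L2_mat: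
  "u \<in> real_points L2_mat \<Longrightarrow> v \<in> real_points L2_mat \<Longrightarrow> omega_std u v = 0"
  by (auto simp: real_points_L2_mat omega_std_herm herm_def sum_3 algebra_simps)

text \<open>In terms of \<open>c = \<alpha> + \<i> \<beta>\<close> and \<open>d = \<alpha> - \<i> \<beta>\<close> the equations become \<open>\<bar>c\<bar>\<^sup>2 = 1 - s\<close>, \<open>\<bar>d\<bar>\<^sup>2 = 1 + s\<close> and
  \<open>c d = w\<close>, solved by \<open>c = sqrt (1 - s)\<close> and \<open>d = w / c\<close>; below, \<open>d = a + \<i> b\<close>. The sign
  condition on \<open>s\<close> keeps \<open>c\<close> away from \<open>0\<close>.\<close>

lemma L2_parametrization:
  assumes norm: "(cmod w)\<^sup>2 + s\<^sup>2 = 1" and "s \<le> 0"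
  shows "\<exists>\<alpha> \<beta>. (cmod \<alpha>)\<^sup>2 + (cmod \<beta>)\<^sup>2 = 1 \<and> \<alpha>\<^sup>2 + \<beta>\<^sup>2 = w \<and>
    cnj \<alpha> * \<beta> - \<alpha> * cnj \<beta> = \<i> * complex_of_real s"
proof -
  define c where "c = sqrt (1 - s)"
  define a b where "a = Re w / c" and "b = Im w / c"
  have c: "c\<^sup>2 = 1 - s" "c \<noteq> 0" using \<open>s \<le> 0\<close> by (simp_all add: c_def)
  have "a\<^sup>2 + b\<^sup>2 = (cmod w)\<^sup>2 / c\<^sup>2"
    by (simp add: a_def b_def cmod_power2 power_divide add_divide_distrib)
  also have "\<dots> = (1 - s) * (1 + s) / (1 - s)"
  proof -
    have "(cmod w)\<^sup>2 = (1 - s) * (1 + s)"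
      using norm by (simp add: power2_eq_square algebra_simps)
    then show ?thesis by (simp only: c(1))
  qed
  also have "\<dots> = 1 + s" using \<open>s \<le> 0\<close> by simp
  finally have ab: "a\<^sup>2 + b\<^sup>2 = 1 + s" .
  have w: "Re w = c * a" "Im w = c * b" using c by (simp_all add: a_def b_def)
  \<comment> \<open>These are \<open>(c + d) / 2\<close> and \<open>(c - d) / (2 * \<i>)\<close> for
    \<open>d = a + \<i> b\<close>.\<close>
  define \<alpha> where "\<alpha> = Complex ((c + a) / 2) (b / 2)"
  define \<beta> where "\<beta> = Complex (- b / 2) ((a - c) / 2)"
  have "(cmod \<alpha>)\<^sup>2 + (cmod \<beta>)\<^sup>2 = (c\<^sup>2 + (a\<^sup>2 + b\<^sup>2)) / 2"
    unfolding cmod_power2 by (simp add: \<alpha>_def \<beta>_def power2_eq_square field_simps)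
  then have "(cmod \<alpha>)\<^sup>2 + (cmod \<beta>)\<^sup>2 = 1" using ab c by simp
  moreover have "\<alpha>\<^sup>2 + \<beta>\<^sup>2 = w"
    by (simp add: \<alpha>_def \<beta>_def complex_eq_iff w power2_eq_square field_simps)
  \<comment> \<open>The difference on the right is \<open>(1 + s) - (1 - s)\<close>, that is, twice
    \<open>s\<close>.\<close>
  moreover have "cnj \<alpha> * \<beta> - \<alpha> * cnj \<beta> = \<i> * complex_of_real (((a\<^sup>2 + b\<^sup>2) - c\<^sup>2) / 2)"
    by (simp add: \<alpha>_def \<beta>_def complex_eq_iff power2_eq_square field_simps)
  ultimately show ?thesis using ab c by auto
qed

text \<open>The coordinates defining \<open>L2\<close> satisfy the equations of the real form.
  Conversely, a nonzero real factor changes neither the projective point nor membership in the real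
  form, and a suitable one achieves the hypotheses of \<open>L2_parametrization\<close>.\<close>

lemma L2_eq: "L2 = proj ` (real_points L2_mat - {0})"
proof (intro equalityI subsetI)
  fix p assume "p \<in> L2"
  then obtain \<alpha> \<beta> where n: "(cmod \<alpha>)\<^sup>2 + (cmod \<beta>)\<^sup>2 = 1"
    and p: "p = proj (vector [(cnj \<alpha>)\<^sup>2 + (cnj \<beta>)\<^sup>2,
      complex_of_real (sqrt 2) * (cnj \<alpha> * \<beta> - \<alpha> * cnj \<beta>), \<alpha>\<^sup>2 + \<beta>\<^sup>2])"
    unfolding L2_def hpoint_def by blast
  then show "p \<in> proj ` (real_points L2_mat - {0})"
    using L2_coordinates_nonzero[OF n]
    by (intro image_eqI[of _ proj, OF p]) (simp add: real_points_L2_mat)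
next
  fix p assume "p \<in> proj ` (real_points L2_mat - {0})"
  then obtain z where z: "z \<in> real_points L2_mat" "z \<noteq> 0" "p = proj z" by auto
  define t where "t = Im (z $ 2)"
  \<comment> \<open>The weight 1/2 compensates the factor \<open>sqrt 2\<close> in the middle
    coordinate of \<open>L2\<close>.\<close>
  define N where "N = sqrt ((cmod (z $ 3))\<^sup>2 + t\<^sup>2 / 2)"
  have z1: "z $ 1 = cnj (z $ 3)" and z2: "z $ 2 = \<i> * complex_of_real t"
    using z(1) by (simp_all add: real_points_L2_mat complex_eq_iff t_def)
  have "z $ 3 \<noteq> 0 \<or> t \<noteq> 0" using z(2) z1 z2 by (auto simp: vec_eq_iff forall_3)
  then have "(cmod (z $ 3))\<^sup>2 + t\<^sup>2 / 2 > 0"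
    by (auto simp: add_pos_nonneg add_nonneg_pos)
  then have N: "N > 0" "N\<^sup>2 = (cmod (z $ 3))\<^sup>2 + t\<^sup>2 / 2" by (simp_all add: N_def)
  \<comment> \<open>The size \<open>1 / N\<close> normalises; the sign secures the condition
    \<open>s \<le> 0\<close> for \<open>s = r * t / sqrt 2\<close>.\<close>
  define r where "r = (if t \<le> 0 then 1 / N else - 1 / N)"
  have r: "r \<noteq> 0" "r\<^sup>2 * N\<^sup>2 = 1" "r * t \<le> 0"
    using N(1) by (auto simp: r_def power_divide divide_nonpos_pos)
  have "(cmod (complex_of_real r * z $ 3))\<^sup>2 + (r * t / sqrt 2)\<^sup>2 = r\<^sup>2 * N\<^sup>2"
    by (simp add: N(2) norm_mult power_mult_distrib power_divide algebra_simps)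
  moreover have "r * t / sqrt 2 \<le> 0" using r(3) by (simp add: divide_nonpos_pos)
  ultimately obtain \<alpha> \<beta> where ab: "(cmod \<alpha>)\<^sup>2 + (cmod \<beta>)\<^sup>2 = 1"
    "\<alpha>\<^sup>2 + \<beta>\<^sup>2 = complex_of_real r * z $ 3"
    "cnj \<alpha> * \<beta> - \<alpha> * cnj \<beta> = \<i> * complex_of_real (r * t / sqrt 2)"
    using L2_parametrization r(2) by metis
  have "(cnj \<alpha>)\<^sup>2 + (cnj \<beta>)\<^sup>2 = cnj (\<alpha>\<^sup>2 + \<beta>\<^sup>2)" by simp
  then have "vector [(cnj \<alpha>)\<^sup>2 + (cnj \<beta>)\<^sup>2,
      complex_of_real (sqrt 2) * (cnj \<alpha> * \<beta> - \<alpha> * cnj \<beta>), \<alpha>\<^sup>2 + \<beta>\<^sup>2] = complex_of_real r *s z"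
    unfolding ab by (simp add: vec_eq_iff forall_3 z1 z2)
  then show "p \<in> L2"
    unfolding L2_def hpoint_def z(3) using ab(1) proj_scale[OF z(2), of "complex_of_real r"] r(1)
    by (smt (verit) mem_Collect_eq of_real_eq_0_iff)
qed

theorem lemma2p2:
  shows "lagrangian fubini_study L2"
  unfolding L2_eq
  by (rule L2.lagrangian_real_points) (rule omega_std_real_points_L2_mat)

end
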